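(* Let $q$ be a prime power and let $r\ge 1$, $t\ge 2$, $m\ge 1$ be integers. The following are equivalent. (a) There exist $m$ sets $A_1,\dots,A_m\subseteq\{1,\dots,q\}$ with $|A_i|=r+1$ for $1\le i\le m$ and $$\left|\bigcup_{i\in S}A_i\right|\ge |S|r+1\quad\text{for every nonempty } S\subseteq\{1,\dots,m\}\text{ with }|S|\le t.$$ (b) There exists an $(r+1)$-uniform hypergraph $H=(\{1,\dots,q\},E)$ with $|E|=m$ that does not contain any Berge $\ell$-cycle for any $2\le\ell\le t$.
   Context: A hypergraph $H=(X,E)$ consists of a vertex set $X$ and a set $E$ of nonempty subsets of $X$ (hyperedges); it is $(r+1)$-uniform if every hyperedge has exactly $r+1$ elements. For $k\ge2$, $H$ contains a Berge $k$-cycle $(v_1,\dots,v_k)$, where $v_1,\dots,v_k$ are distinct vertices, if there exist $k$ distinct hyperedges $e_1,\dots,e_k\in E$ such that $\{v_{i-1},v_i\}\subseteq e_i$ for $i=2,\dots,k$ and $\{v_1,v_k\}\subseteq e_1$. *)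

theory Defs
  imports Main "HOL-Number_Theory.Prime_Powers"
begin

definition hypergraph :: "'a set \<Rightarrow> 'a set set \<Rightarrow> bool" where
  "hypergraph X E \<longleftrightarrow> (\<forall>e\<in>E. e \<noteq> {} \<and> e \<subseteq> X)"

definition uniform :: "nat \<Rightarrow> 'a set set \<Rightarrow> bool" where
  "uniform k E \<longleftrightarrow> (\<forall>e\<in>E. card e = k)"

(* The cycle (v_1, ..., v_k) is given by the values of v on {1..k}; values of v and e
   outside {1..k} are irrelevant. Only meaningful for k >= 2. *)
definition berge_cycle :: "'a set \<Rightarrow> 'a set set \<Rightarrow> nat \<Rightarrow> (nat \<Rightarrow> 'a) \<Rightarrow> bool" where
  "berge_cycle X E k v \<longleftrightarrow>
     v ` {1..k} \<subseteq> X \<and> inj_on v {1..k} \<and>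
     (\<exists>e. e ` {1..k} \<subseteq> E \<and> inj_on e {1..k} \<and>
        (\<forall>i\<in>{2..k}. {v (i - 1), v i} \<subseteq> e i) \<and> {v 1, v k} \<subseteq> e 1)"

definition contains_berge_cycle :: "'a set \<Rightarrow> 'a set set \<Rightarrow> nat \<Rightarrow> bool" where
  "contains_berge_cycle X E k \<longleftrightarrow> (\<exists>v. berge_cycle X E k v)"

end

theory Submission
  imports Defs
begin

text \<open>
  The edges and vertices of a Berge \<open>l\<close>-cycle span at most \<open>l + l(r - 1) = lr\<close> vertices, since each
  of the \<open>l\<close> edges contributes at most \<open>r - 1\<close> vertices outside the cycle; so the union bound in (a)
  excludes short cycles.
  Conversely, if a family of edges has no Berge cycle, some edge meets the union of the others in
  at most one vertex (otherwise a path could be prolonged forever); deleting that edge removes at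
  least \<open>r\<close> vertices from the union, and the union bound follows by induction.
\<close>

lemma contains_berge_cycle_mono:
  assumes "contains_berge_cycle X E k" "X \<subseteq> Y" "E \<subseteq> F"
  shows "contains_berge_cycle Y F k"
proof -
  have "v ` {1..k} \<subseteq> X \<Longrightarrow> v ` {1..k} \<subseteq> Y" "e ` {1..k} \<subseteq> E \<Longrightarrow> e ` {1..k} \<subseteq> F"
    for v :: "nat \<Rightarrow> 'a" and e :: "nat \<Rightarrow> 'a set"
    using subset_trans[OF _ assms(2)] subset_trans[OF _ assms(3)] by simp_all
  with assms(1) show ?thesis
    unfolding contains_berge_cycle_def berge_cycle_def by (elim ex_forward conj_forward)
qed

lemma card_Union_berge_cycle_le:
  assumes e: "inj_on e {1..l}" "\<forall>i\<in>{2..l}. {v (i - 1), v i} \<subseteq> e i" "{v 1, v l} \<subseteq> e 1"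
    and v: "inj_on v {1..l}"
    and card: "\<forall>i\<in>{1..l}. card (e i) = r + 1"
    and l: "l \<ge> 2"
  shows "card (\<Union>i\<in>{1..l}. e i) \<le> l * r"
proof -
  \<comment> \<open>\<open>p i\<close> is the cyclic predecessor of \<open>i\<close>; it lets the
    closing edge \<open>e 1\<close>, joining \<open>v 1\<close> and \<open>v l\<close>, be treated
    like all others. \<open>l \<ge> 2\<close> ensures \<open>p i \<noteq> i\<close>, so each edge
    holds two distinct cycle vertices.\<close>
  define p where "p i = (if i = 1 then l else i - 1)" for i :: nat
  have p: "p i \<in> {1..l}" "p i \<noteq> i" "v i \<in> e i" "v (p i) \<in> e i" if "i \<in> {1..l}" for i
    using that l e(2,3) by (cases "i = 1"; auto simp: p_def)+
  define B where "B i = e i - {v i, v (p i)}" for i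
  have fin: "finite (e i)" if "i \<in> {1..l}" for i
    using card that by (metis card.infinite add_is_0 one_neq_zero)
  have B: "card (B i) = r - 1" if "i \<in> {1..l}" for i
  proof -
    have "v i \<noteq> v (p i)" using inj_onD[OF v] p that by metis
    then show ?thesis
      using p[OF that] card that fin[OF that] unfolding B_def by (subst card_Diff_subset) auto
  qed
  \<comment> \<open>Subtraction on naturals truncates, so \<open>l + l * (r - 1) = l * r\<close>
    would fail for \<open>r = 0\<close>. The two distinct cycle vertices in \<open>e 1\<close>
    exclude that case.\<close>
  have "r \<ge> 1"
  proof -
    have "1 \<in> {1..l}" using l by simp
    moreover have "v 1 \<noteq> v (p 1)" using inj_onD[OF v] p calculation by metis
    ultimately have "card {v 1, v (p 1)} = 2" "{v 1, v (p 1)} \<subseteq> e 1" "card (e 1) = r + 1"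
      using p[of 1] card by auto
    then show ?thesis
      using card_mono[OF fin[OF \<open>1 \<in> {1..l}\<close>], of "{v 1, v (p 1)}"] by linarith
  qed
  have "(\<Union>i\<in>{1..l}. e i) \<subseteq> v ` {1..l} \<union> (\<Union>i\<in>{1..l}. B i)"
    using p(1) unfolding B_def by blast
  then have "card (\<Union>i\<in>{1..l}. e i) \<le> card (v ` {1..l} \<union> (\<Union>i\<in>{1..l}. B i))"
    using fin by (intro card_mono) (auto simp: B_def)
  also have "\<dots> \<le> card (v ` {1..l}) + card (\<Union>i\<in>{1..l}. B i)"
    by (rule card_Un_le)
  also have "\<dots> \<le> l + (\<Sum>i\<in>{1..l}. card (B i))"
    using card_image_le[of "{1..l}" v] card_UN_le[of "{1..l}" B] by simp
  also have "\<dots> = l + l * (r - 1)" using B by simp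
  also have "\<dots> = l * r" using \<open>r \<ge> 1\<close> by (cases r) auto
  finally show ?thesis .
qed

text \<open>A path of edges can always leave its last edge through a vertex other than the one it
  entered by. Finiteness forces it to return to itself, and the first return closes a cycle. The
  contrapositive yields the edge to delete in the induction below.\<close>

lemma berge_cycle_from_overlaps:
  assumes "finite F" "F \<noteq> {}"
    and overlap: "\<And>e. e \<in> F \<Longrightarrow> 2 \<le> card (e \<inter> \<Union>(F - {e}))"
  shows "\<exists>l\<in>{2..card F}. contains_berge_cycle (\<Union>F) F l"
proof (rule ccontr)
  assume acyclic: "\<not> ?thesis"
  \<comment> \<open>\<open>v i\<close> is the vertex through which the path passes from
    \<open>e (i - 1)\<close> to \<open>e i\<close>, so connecting vertices start at index 2.\<close>
  define path where "path n e v \<longleftrightarrow> e ` {1..n} \<subseteq> F \<and> inj_on e {1..n} \<and> inj_on v {2..n} \<and>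
    (\<forall>i\<in>{2..n}. v i \<in> e (i - 1) \<and> v i \<in> e i)" for n :: nat and e :: "nat \<Rightarrow> 'a set" and v
  have "\<exists>e v. path (Suc n) e v" for n
  proof (induction n)
    case 0
    from \<open>F \<noteq> {}\<close> obtain f where "f \<in> F" by blast
    then have "path (Suc 0) (\<lambda>_. f) (\<lambda>_. undefined)" by (simp add: path_def)
    then show ?case by blast
  next
    case (Suc k)
    define n where "n = Suc k"
    obtain e v where p: "path n e v" using Suc n_def by blast
    have n: "n \<ge> 1" by (simp add: n_def)
    have eF: "e i \<in> F" if "1 \<le> i" "i \<le> n" for i using p that by (auto simp: path_def)
    have inje: "inj_on e {1..n}" and injv: "inj_on v {2..n}"
      and ve: "\<And>i. 2 \<le> i \<Longrightarrow> i \<le> n \<Longrightarrow> v i \<in> e (i - 1) \<and> v i \<in> e i"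
      using p by (auto simp: path_def)
    \<comment> \<open>Of the two shared vertices at least one differs from the entry vertex
      \<open>v n\<close>. For \<open>n = 1\<close> the value \<open>v 1\<close> is arbitrary, but
      excluding it still leaves a shared vertex.\<close>
    have "\<not> e n \<inter> \<Union>(F - {e n}) \<subseteq> {v n}"
      using overlap[OF eF[of n]] card_mono[of "{v n}" "e n \<inter> \<Union>(F - {e n})"] n by auto
    then obtain x f where x: "x \<in> e n" "x \<noteq> v n" and f: "f \<in> F" "f \<noteq> e n" "x \<in> f"
      by blast
    \<comment> \<open>Earlier edges that contain the exit vertex \<open>x\<close>: any such edge
      would close a cycle.\<close>
    define J where "J = {j. 1 \<le> j \<and> j < n \<and> x \<in> e j}"
    have "J = {}"
    proof (rule ccontr)
      assume "J \<noteq> {}"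
      have "finite J" by (rule finite_subset[of _ "{..n}"]) (auto simp: J_def)
      define j where "j = Max J"
      have "j \<in> J" and jmax: "\<And>i. i \<in> J \<Longrightarrow> i \<le> j"
        using \<open>finite J\<close> \<open>J \<noteq> {}\<close> by (auto simp: j_def)
      then have j: "1 \<le> j" "j < n" "x \<in> e j" by (auto simp: J_def)
      \<comment> \<open>Maximality of \<open>j\<close> makes \<open>x\<close> differ from the later
        connecting vertices: \<open>x = v i\<close> with \<open>j < i < n\<close> would put
        \<open>i\<close> into \<open>J\<close>.\<close>
      have xv: "x \<noteq> v i" if "j < i" "i \<le> n" for i
      proof
        assume eq: "x = v i"
        then have "i \<noteq> n" using x by auto
        then have "i \<in> J" using ve[of i] eq that j by (auto simp: J_def)
        then show False using jmax that by fastforce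
      qed
      \<comment> \<open>The cycle uses the edges \<open>e j, ..., e n\<close> and the vertices
        \<open>v (j + 1), ..., v n, x\<close>. The vertex \<open>x\<close> closes it, lying in both
        \<open>e n\<close> and \<open>e j\<close>. The shift by one in \<open>g\<close> places
        \<open>w (i - 1)\<close> and \<open>w i\<close> in \<open>g i\<close>.\<close>
      define l where "l = n - j + 1"
      have l: "2 \<le> l" "j + l = n + 1" using j by (auto simp: l_def)
      define w where "w i = (if i = l then x else v (j + i))" for i
      define g where "g i = e (j + i - 1)" for i
      have "w i \<in> \<Union>F" if "i \<in> {1..l}" for i
      proof (cases "i = l")
        case True
        then show ?thesis using f by (auto simp: w_def)
      next
        case False
        then show ?thesis
          using that ve[of "j + i"] eF[of "j + i"] l j by (auto simp: w_def)
      qed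
      moreover have "inj_on w {1..l}"
      proof (rule inj_onI)
        fix a b assume ab: "a \<in> {1..l}" "b \<in> {1..l}" "w a = w b"
        have "v (j + a) = v (j + b) \<Longrightarrow> a \<noteq> l \<Longrightarrow> b \<noteq> l \<Longrightarrow> a = b"
          using inj_onD[OF injv, of "j + a" "j + b"] ab(1,2) l j by auto
        then show "a = b"
          using ab xv[of "j + a"] xv[of "j + b"] l j by (auto simp: w_def split: if_splits)
      qed
      moreover have "g ` {1..l} \<subseteq> F" using eF l j by (auto simp: g_def)
      moreover have "inj_on g {1..l}"
      proof (rule inj_onI)
        fix a b assume ab: "a \<in> {1..l}" "b \<in> {1..l}" "g a = g b"
        then have "j + a - 1 = j + b - 1"
          using l j by (intro inj_onD[OF inje]) (auto simp: g_def)
        then show "a = b" using ab j by simp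
      qed
      moreover have "{w (i - 1), w i} \<subseteq> g i" if "i \<in> {2..l}" for i
      proof -
        have "v (j + (i - 1)) \<in> e (j + i - 1)"
          using ve[of "j + (i - 1)"] that l j by auto
        moreover have "i \<noteq> l \<Longrightarrow> v (j + i) \<in> e (j + i - 1)"
          using ve[of "j + i"] that l j by auto
        ultimately show ?thesis
          using that x l by (auto simp: w_def g_def)
      qed
      moreover have "{w 1, w l} \<subseteq> g 1"
        using ve[of "j + 1"] j l by (auto simp: w_def g_def)
      ultimately have "contains_berge_cycle (\<Union>F) F l"
        unfolding contains_berge_cycle_def berge_cycle_def by (blast intro: image_subsetI)
      moreover have "l \<le> card F"
        using \<open>g ` {1..l} \<subseteq> F\<close> \<open>inj_on g {1..l}\<close> \<open>finite F\<close>
        by (metis card_image card_mono card_atLeastAtMost diff_Suc_1)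
      ultimately show False using acyclic l by auto
    qed
    \<comment> \<open>Since \<open>x\<close> lies in no earlier edge, \<open>f\<close> is a new
      edge; \<open>x\<close> is a new vertex because each \<open>v i\<close> already lies in
      \<open>e (i - 1)\<close>.\<close>
    have new_f: "f \<noteq> e i" if "1 \<le> i" "i \<le> n" for i
      using \<open>J = {}\<close> that f by (cases "i = n") (auto simp: J_def)
    have new_x: "x \<noteq> v i" if "2 \<le> i" "i \<le> n" for i
    proof
      assume "x = v i"
      then have "i - 1 \<in> J" using ve[of i] that by (auto simp: J_def)
      then show False using \<open>J = {}\<close> by blast
    qed
    have "path (Suc n) (e(Suc n := f)) (v(Suc n := x))"
      unfolding path_def
    proof (intro conjI ballI)
      show "e(Suc n := f) ` {1..Suc n} \<subseteq> F" using eF f by auto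
      have "inj_on (e(Suc n := f)) {1..n}" "inj_on (v(Suc n := x)) {2..n}"
        using inje injv inj_on_cong[of "{1..n}" "e(Suc n := f)" e]
          inj_on_cong[of "{2..n}" "v(Suc n := x)" v] by simp_all
      moreover have "{1..Suc n} = insert (Suc n) {1..n}" "{2..Suc n} = insert (Suc n) {2..n}"
        using n by (simp_all add: atLeastAtMostSuc_conv)
      moreover have "f \<notin> e ` {1..n}" "x \<notin> v ` {2..n}"
        using new_f new_x by fastforce+
      ultimately show "inj_on (e(Suc n := f)) {1..Suc n}" "inj_on (v(Suc n := x)) {2..Suc n}"
        by simp_all
      fix i assume "i \<in> {2..Suc n}"
      then show "(v(Suc n := x)) i \<in> (e(Suc n := f)) (i - 1)"
        and "(v(Suc n := x)) i \<in> (e(Suc n := f)) i"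
        using ve[of i] x f n by (auto simp: le_Suc_eq)
    qed
    then show ?case unfolding n_def by blast
  qed
  \<comment> \<open>Pigeonhole: a path cannot have \<open>card F + 1\<close> distinct edges in
    \<open>F\<close>.\<close>
  then obtain e v where "path (Suc (card F)) e v" by blast
  then have "card {1..Suc (card F)} \<le> card F"
    unfolding path_def using \<open>finite F\<close> by (metis card_image card_mono)
  then show False by simp
qed

text \<open>Induction by deleting an edge that meets the rest in at most one vertex. Restricting the
  forbidden lengths to \<open>card F\<close> lets the hypothesis pass to subfamilies and suits
  families of at most \<open>t\<close> edges.\<close>

lemma card_Union_acyclic_ge:
  assumes "finite F" "F \<noteq> {}" "uniform (r + 1) F"
    and "\<forall>l\<in>{2..card F}. \<not> contains_berge_cycle (\<Union>F) F l"
  shows "card F * r + 1 \<le> card (\<Union>F)"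
  using assms
proof (induction rule: finite_psubset_induct)
  case (psubset F)
  obtain e where e: "e \<in> F" and small: "card (e \<inter> \<Union>(F - {e})) \<le> 1"
    using berge_cycle_from_overlaps[OF psubset.hyps] psubset.prems by fastforce
  define G where "G = F - {e}"
  have card_edge: "card f = r + 1" if "f \<in> F" for f
    using psubset.prems(2) that by (auto simp: uniform_def)
  have fin: "finite f" if "f \<in> F" for f
    using card_edge[OF that] card.infinite by fastforce
  have F: "card F = Suc (card G)"
    using e \<open>finite F\<close> unfolding G_def by (metis card.remove)
  show ?case
  proof (cases "G = {}")
    case True
    then have "F = {e}" using e by (auto simp: G_def)
    then show ?thesis using card_edge by simp
  next
    case False
    have "\<not> contains_berge_cycle (\<Union>G) G l" if "l \<in> {2..card G}" for l
      using contains_berge_cycle_mono[of "\<Union>G" G l "\<Union>F" F] psubset.prems(3) that F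
      by (auto simp: G_def)
    then have "card G * r + 1 \<le> card (\<Union>G)"
      using psubset.IH[of G] False psubset.prems(2) e by (auto simp: G_def uniform_def)
    \<comment> \<open>Inclusion-exclusion: of the \<open>r + 1\<close> vertices of \<open>e\<close>
      at most one lies in \<open>\<Union>G\<close>, so at least \<open>r\<close> are new.\<close>
    moreover have "card e + card (\<Union>G) = card (\<Union>F) + card (e \<inter> \<Union>G)"
    proof -
      have "\<Union>F = e \<union> \<Union>G" using e by (auto simp: G_def)
      moreover have "finite (\<Union>G)" using fin \<open>finite F\<close> by (auto simp: G_def)
      ultimately show ?thesis using card_Un_Int[of e "\<Union>G"] fin e by simp
    qed
    ultimately show ?thesis using small card_edge[OF e] F by (simp add: G_def)
  qed
qed

theorem lemma5p1:
  fixes q r t m :: nat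
  assumes "primepow q" and "r \<ge> 1" and "t \<ge> 2" and "m \<ge> 1"
  shows
    "(\<exists>A :: nat \<Rightarrow> nat set.
        (\<forall>i\<in>{1..m}. A i \<subseteq> {1..q} \<and> card (A i) = r + 1) \<and>
        (\<forall>S. S \<noteq> {} \<and> S \<subseteq> {1..m} \<and> card S \<le> t \<longrightarrow>
           card (\<Union>i\<in>S. A i) \<ge> card S * r + 1))
     \<longleftrightarrow>
     (\<exists>E :: nat set set.
        hypergraph {1..q} E \<and> uniform (r + 1) E \<and> card E = m \<and>
        (\<forall>l\<in>{2..t}. \<not> contains_berge_cycle {1..q} E l))"
proof
  assume "\<exists>A :: nat \<Rightarrow> nat set.
        (\<forall>i\<in>{1..m}. A i \<subseteq> {1..q} \<and> card (A i) = r + 1) \<and>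
        (\<forall>S. S \<noteq> {} \<and> S \<subseteq> {1..m} \<and> card S \<le> t \<longrightarrow>
           card (\<Union>i\<in>S. A i) \<ge> card S * r + 1)"
  then obtain A :: "nat \<Rightarrow> nat set"
    where edges: "\<forall>i\<in>{1..m}. A i \<subseteq> {1..q} \<and> card (A i) = r + 1"
      and unions: "\<forall>S. S \<noteq> {} \<and> S \<subseteq> {1..m} \<and> card S \<le> t \<longrightarrow>
        card (\<Union>i\<in>S. A i) \<ge> card S * r + 1"
    by (elim exE conjE)
  have A: "A i \<subseteq> {1..q}" "card (A i) = r + 1" if "i \<in> {1..m}" for i
    using edges that by auto
  have large: "card S * r + 1 \<le> card (\<Union>i\<in>S. A i)"
    if "S \<noteq> {}" "S \<subseteq> {1..m}" "card S \<le> t" for S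
    using unions that by simp
  \<comment> \<open>Two equal sets would have a union of size \<open>r + 1 < 2 * r + 1\<close>,
    against the bound for two indices, available as \<open>t \<ge> 2\<close>.\<close>
  have inj: "inj_on A {1..m}"
  proof (rule inj_onI, rule ccontr)
    fix i j assume ij: "i \<in> {1..m}" "j \<in> {1..m}" "A i = A j" "i \<noteq> j"
    then show False
      using large[of "{i, j}"] A(2)[of j] assms by auto
  qed
  let ?E = "A ` {1..m}"
  have "\<not> contains_berge_cycle {1..q} ?E l" if l: "l \<in> {2..t}" for l
  proof
    assume "contains_berge_cycle {1..q} ?E l"
    then obtain v e where v: "inj_on v {1..l}" and e: "e ` {1..l} \<subseteq> ?E" "inj_on e {1..l}"
      "\<forall>i\<in>{2..l}. {v (i - 1), v i} \<subseteq> e i" "{v 1, v l} \<subseteq> e 1"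
      unfolding contains_berge_cycle_def berge_cycle_def by (elim exE conjE)
    \<comment> \<open>Pulling the cycle edges back to indices gives exactly \<open>l \<le> t\<close>
      of them by injectivity, so the lower bound in (a) contradicts the upper bound for a
      cycle.\<close>
    obtain S where S: "S \<subseteq> {1..m}" "e ` {1..l} = A ` S"
      using e(1) by (meson subset_imageE)
    have "card S = l"
      using S card_image[OF e(2)] card_image[OF inj_on_subset[OF inj S(1)]] by simp
    moreover have "S \<noteq> {}" using \<open>card S = l\<close> l by auto
    ultimately have "l * r + 1 \<le> card (\<Union>i\<in>S. A i)"
      using large[of S] S l by auto
    moreover have "\<forall>i\<in>{1..l}. card (e i) = r + 1"
    proof
      fix i assume "i \<in> {1..l}"
      then have "e i \<in> ?E" using e(1) by (meson image_eqI subsetD)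
      then show "card (e i) = r + 1" using A(2) by auto
    qed
    then have "card (\<Union>i\<in>{1..l}. e i) \<le> l * r"
      using l by (intro card_Union_berge_cycle_le[OF e(2-4) v]) simp_all
    ultimately show False unfolding S(2) by linarith
  qed
  moreover have "hypergraph {1..q} ?E"
    using A by (fastforce simp: hypergraph_def)
  moreover have "uniform (r + 1) ?E" using A by (auto simp: uniform_def)
  moreover have "card ?E = m" using card_image[OF inj] by simp
  ultimately show "\<exists>E :: nat set set.
        hypergraph {1..q} E \<and> uniform (r + 1) E \<and> card E = m \<and>
        (\<forall>l\<in>{2..t}. \<not> contains_berge_cycle {1..q} E l)"
    by (intro exI[of _ ?E]) simp
next
  assume "\<exists>E :: nat set set.
        hypergraph {1..q} E \<and> uniform (r + 1) E \<and> card E = m \<and>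
        (\<forall>l\<in>{2..t}. \<not> contains_berge_cycle {1..q} E l)"
  then obtain E :: "nat set set" where E: "hypergraph {1..q} E" "uniform (r + 1) E" "card E = m"
    and acyclic: "\<forall>l\<in>{2..t}. \<not> contains_berge_cycle {1..q} E l"
    by (elim exE conjE)
  \<comment> \<open>An infinite \<open>E\<close> would have cardinality 0, contrary to
    \<open>m \<ge> 1\<close>.\<close>
  have "finite E" using E(3) assms(4) card.infinite by fastforce
  then obtain A where A: "bij_betw A {1..m} E"
    using E(3) ex_bij_betw_nat_finite_1 by blast
  have "card S * r + 1 \<le> card (\<Union>i\<in>S. A i)"
    if S: "S \<noteq> {}" "S \<subseteq> {1..m}" "card S \<le> t" for S
  proof -
    have sub: "A ` S \<subseteq> E" using A S(2) by (auto simp: bij_betw_def)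
    have card: "card (A ` S) = card S"
      using A S(2) by (meson bij_betw_def card_image inj_on_subset)
    \<comment> \<open>A Berge cycle in the subfamily would also be one in \<open>E\<close> on
      \<open>{1..q}\<close>, of length at most \<open>card S \<le> t\<close>.\<close>
    have "\<Union>(A ` S) \<subseteq> {1..q}" using sub E(1) by (fastforce simp: hypergraph_def)
    then have "\<forall>l\<in>{2..card (A ` S)}. \<not> contains_berge_cycle (\<Union>(A ` S)) (A ` S) l"
      using acyclic sub card S(3) contains_berge_cycle_mono by (metis atLeastAtMost_iff le_trans)
    moreover have "uniform (r + 1) (A ` S)" using sub E(2) by (auto simp: uniform_def)
    moreover have "finite (A ` S)" using sub \<open>finite E\<close> finite_subset by blast
    ultimately show ?thesis
      using card_Union_acyclic_ge[of "A ` S" r] S(1) card by auto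
  qed
  moreover have "A i \<subseteq> {1..q} \<and> card (A i) = r + 1" if "i \<in> {1..m}" for i
    using bij_betwE[OF A] that E(1,2) unfolding hypergraph_def uniform_def by blast
  ultimately show "\<exists>A :: nat \<Rightarrow> nat set.
        (\<forall>i\<in>{1..m}. A i \<subseteq> {1..q} \<and> card (A i) = r + 1) \<and>
        (\<forall>S. S \<noteq> {} \<and> S \<subseteq> {1..m} \<and> card S \<le> t \<longrightarrow>
           card (\<Union>i\<in>S. A i) \<ge> card S * r + 1)"
    by (intro exI[of _ A]) simp
qed

end
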